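(* Let $A,B\subset\mathbb{R}^n$ be nonempty closed convex sets such that $A\cap B\neq\varnothing$ and $A$ is compact. Let $(\epsilon_k)_{k\in\mathbb{N}}$ and $(\delta_k)_{k\in\mathbb{N}}$ be sequences of non-negative real numbers, and let $\bar\epsilon$ be a real number such that $\bar\epsilon\neq 0$ and $0\le 2(\epsilon_k+\delta_k)\le\bar\epsilon<1$ for all $k$. Let $\{x^k\}_{k\in\mathbb{N}^*}$ be an (infinite) sequence generated by the Approximate Douglas-Rachford algorithm for $A,B$ with these parameters, and let $\{y_A^k\}_{k\in\mathbb{N}}$, $\{y_B^k\}_{k\in\mathbb{N}}$ be the associated sequences of inexact projections. Then $\{x^k\}_{k\in\mathbb{N}^*}$ converges to a point $x^*\in\mathrm{Fix}\,\mathcal{T}_{A,B}$. As a consequence, $\{y_A^k\}_{k\in\mathbb{N}}$ converges to $\mathcal{P}_A(x^* )$, and $\mathcal{P}_A(x^* )\in A\cap B$.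
   Context: $\mathbb{N}=\{0,1,2,\dots\}$, $\mathbb{N}^*=\{1,2,\dots\}$; $\langle\cdot,\cdot\rangle$ and $\|\cdot\|$ are the Euclidean inner product and norm on $\mathbb{R}^n$. For a nonempty closed convex set $C\subset\mathbb{R}^n$, $\mathcal{P}_C(v)=\arg\min_{z\in C}\|v-z\|$ is the projection onto $C$, $\mathcal{R}_C(v)=2\mathcal{P}_C(v)-v$ is the reflection, and the Douglas-Rachford operator is $\mathcal{T}_{A,B}(u)=\frac12\big(\mathcal{R}_B(\mathcal{R}_A(u))+u\big)$. $\mathrm{Fix}\,\mathcal{T}_{A,B}=\{x\in\mathbb{R}^n: \mathcal{T}_{A,B}(x)=x\}$. Feasible inexact projection: for $y\in C$, $v,u\in\mathbb{R}^n$ and $\epsilon\ge 0$, $$\mathcal{P}^{\epsilon}_C(y,v,u)=\{y^+\in C:\ \langle u-y^+,z-y^+\rangle\le\epsilon\|y-v\|^2\ \ \forall z\in C\}.$$ Approximate Douglas-Rachford (ApDR) algorithm: given sequences of non-negative reals $(\epsilon_k)_{k\in\mathbb{N}}$, $(\delta_k)_{k\in\mathbb{N}}$, and starting points $y_A^0\in A$, $y_B^0\in B$, $x^1\in\mathbb{R}^n$, for $k=1,2,\dots$ choose (arbitrarily) $$y_A^k\in\mathcal{P}_A^{\epsilon_k}(y_A^{k-1},y_B^{k-1},x^k),\qquad y_B^k\in\mathcal{P}_B^{\delta_k}(y_B^{k-1},y_A^{k-1},2y_A^k-x^k);$$ if $y_B^k=y_A^k$ stop; otherwise set $x^{k+1}=x^k+y_B^k-y_A^k$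 and continue. An infinite sequence generated by the algorithm is one for which the algorithm never stops, i.e. $y_A^k\ne y_B^k$ for all $k\ge1$. *)

theory Defs
  imports "HOL-Analysis.Analysis"
begin

text \<open>The projection onto a nonempty closed convex set \<open>C\<close> is the library function
  \<^const>\<open>closest_point\<close>.\<close>

definition reflection :: "'a::euclidean_space set \<Rightarrow> 'a \<Rightarrow> 'a" where
  "reflection C v = 2 *\<^sub>R closest_point C v - v"

definition DR_operator :: "'a::euclidean_space set \<Rightarrow> 'a set \<Rightarrow> 'a \<Rightarrow> 'a" where
  "DR_operator A B u = (1/2) *\<^sub>R (reflection B (reflection A u) + u)"

definition Fix :: "('a \<Rightarrow> 'a) \<Rightarrow> 'a set" where
  "Fix T = {x. T x = x}"

text \<open>The reference point \<open>y\<close> is meant to lie in \<open>C\<close>, and \<open>e\<close> to be non-negative;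
  the set itself is defined without these restrictions.\<close>

definition inexact_proj ::
  "'a::euclidean_space set \<Rightarrow> real \<Rightarrow> 'a \<Rightarrow> 'a \<Rightarrow> 'a \<Rightarrow> 'a set" where
  "inexact_proj C e y v u =
     {y' \<in> C. \<forall>z\<in>C. (u - y') \<bullet> (z - y') \<le> e * (norm (y - v))\<^sup>2}"

text \<open>An infinite run of the approximate Douglas-Rachford algorithm, i.e. one in which the
  stopping test never succeeds. The iterates \<open>x k\<close> are indexed by \<open>k \<ge> 1\<close>; the value \<open>x 0\<close>
  is unconstrained and plays no role.\<close>

definition ApDR_infinite_run ::
  "'a::euclidean_space set \<Rightarrow> 'a set \<Rightarrow> (nat \<Rightarrow> real) \<Rightarrow> (nat \<Rightarrow> real) \<Rightarrow>
   (nat \<Rightarrow> 'a) \<Rightarrow> (nat \<Rightarrow> 'a) \<Rightarrow> (nat \<Rightarrow> 'a) \<Rightarrow> bool" where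
  "ApDR_infinite_run A B \<epsilon> \<delta> x yA yB \<longleftrightarrow>
     yA 0 \<in> A \<and> yB 0 \<in> B \<and>
     (\<forall>k\<ge>1.
        yA k \<in> inexact_proj A (\<epsilon> k) (yA (k - 1)) (yB (k - 1)) (x k) \<and>
        yB k \<in> inexact_proj B (\<delta> k) (yB (k - 1)) (yA (k - 1)) (2 *\<^sub>R yA k - x k) \<and>
        yA k \<noteq> yB k \<and>
        x (k + 1) = x k + yB k - yA k)"

end

theory Submission
  imports Defs
begin

text \<open>
  The key is a quasi-Fejer inequality. A point \<open>u = p + n\<close> with \<open>p \<in> A \<inter> B\<close>, \<open>n\<close> normal to \<open>A\<close>
  at \<open>p\<close> and \<open>-n\<close> normal to \<open>B\<close> at \<open>p\<close> is a fixed point of the Douglas-Rachford operator. Write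
  \<open>d k = \<parallel>yA k - yB k\<parallel>\<^sup>2\<close>. Testing both inexact projections with \<open>p\<close> gives, for every such \<open>u\<close>
  and for every point \<open>u\<close> of \<open>A \<inter> B\<close> (take \<open>n = 0\<close>),
  \<open>\<parallel>x (k + 1) - u\<parallel>\<^sup>2 + d k \<le> \<parallel>x k - u\<parallel>\<^sup>2 + 2 (\<epsilon> k + \<delta> k) d (k - 1)\<close>
  (lemma \<open>ApDR_step_quasi_fejer\<close>). As \<open>2 (\<epsilon> k + \<delta> k)\<close> is at most a constant \<open>c < 1\<close>, the
  quantities \<open>\<parallel>x (k + 1) - u\<parallel>\<^sup>2 + c d k\<close> decrease, by at least \<open>(1 - c) d (k + 1)\<close> each. Hence
  \<open>d\<close> tends to \<open>0\<close> and \<open>\<parallel>x k - u\<parallel>\<close> converges (lemma \<open>perturbed_descent\<close>).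

  A point of \<open>A \<inter> B\<close> as \<open>u\<close> shows that \<open>x\<close> is bounded, so it has a cluster point \<open>x_star\<close>.
  The error of \<open>yA k\<close> as an approximation of the exact projection of \<open>x k\<close> is controlled by
  \<open>d (k - 1)\<close>, so along the subsequence both \<open>yA\<close> and \<open>yB\<close> tend to \<open>p = closest_point A x_star\<close>.
  In the limit the two projection inequalities say that \<open>x_star = p + n\<close> has the form above.
  So \<open>u = x_star\<close> is admissible, \<open>\<parallel>x k - x_star\<parallel>\<close> converges, and its limit is \<open>0\<close> because
  it is \<open>0\<close> along the subsequence.
\<close>

lemma perturbed_descent:
  fixes e d :: "nat \<Rightarrow> real" and c :: real
  assumes e: "\<And>k. 0 \<le> e k" and d: "\<And>k. 0 \<le> d k" and c: "0 \<le> c" "c < 1"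
    and descent: "\<And>k. e (Suc k) + d (Suc k) \<le> e k + c * d k"
  shows "d \<longlonglongrightarrow> 0" and "convergent e"
proof -
  define V where "V k = e k + c * d k" for k
  have gap: "(1 - c) * d (Suc k) \<le> V k - V (Suc k)" for k
    using descent[of k] by (simp add: V_def algebra_simps)
  have "0 \<le> (1 - c) * d (Suc k)" for k
    using c d by simp
  then have "decseq V"
    by (intro decseq_SucI) (meson gap diff_ge_0_iff_ge order_trans)
  moreover have "0 \<le> V k" for k
    using e d c by (simp add: V_def)
  ultimately obtain L where L: "V \<longlonglongrightarrow> L"
    using decseq_convergent by blast
  then have "(\<lambda>k. V k - V (Suc k)) \<longlonglongrightarrow> L - L"
    by (intro tendsto_diff LIMSEQ_Suc)
  then have lim: "(\<lambda>k. (V k - V (Suc k)) / (1 - c)) \<longlonglongrightarrow> 0"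
    using tendsto_divide[of _ "L - L" _ "\<lambda>_. 1 - c" "1 - c"] c by simp
  have "norm (d (Suc k)) \<le> (V k - V (Suc k)) / (1 - c)" for k
    using gap[of k] c d[of "Suc k"] by (simp add: pos_le_divide_eq mult.commute)
  then have "\<forall>k. norm (d (Suc k)) \<le> (V k - V (Suc k)) / (1 - c)"
    by simp
  from Lim_null_comparison[OF always_eventually[OF this] lim]
  have "(\<lambda>k. d (Suc k)) \<longlonglongrightarrow> 0" .
  then show d0: "d \<longlonglongrightarrow> 0"
    by (rule LIMSEQ_imp_Suc)
  have "(\<lambda>k. V k - c * d k) \<longlonglongrightarrow> L - c * 0"
    by (intro tendsto_intros L d0)
  then have "e \<longlonglongrightarrow> L"
    by (simp add: V_def)
  then show "convergent e"
    by (rule convergentI)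
qed

lemma closest_point_inexact_proj:
  assumes C: "closed C" "convex C" and y: "y \<in> inexact_proj C e r v u"
  shows "(dist (closest_point C u) y)\<^sup>2 \<le> e * (norm (r - v))\<^sup>2"
proof -
  let ?p = "closest_point C u"
  have yC: "y \<in> C"
    using y by (simp add: inexact_proj_def)
  then have "?p \<in> C"
    using closest_point_in_set[OF C(1)] by auto
  then have "(u - y) \<bullet> (?p - y) \<le> e * (norm (r - v))\<^sup>2"
    using y by (simp add: inexact_proj_def)
  moreover have "(u - ?p) \<bullet> (y - ?p) \<le> 0"
    by (rule closest_point_dot[OF C(2,1) yC])
  moreover have "(dist ?p y)\<^sup>2 = (u - y) \<bullet> (?p - y) + (u - ?p) \<bullet> (y - ?p)"
    by (simp add: dist_norm power2_norm_eq_inner inner_simps inner_commute)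
  ultimately show ?thesis
    by linarith
qed

text \<open>Here and in \<open>ApDR_step_quasi_fejer\<close>, the hypotheses say that \<open>n = u - p\<close> is normal to \<open>A\<close>
  and \<open>-n\<close> is normal to \<open>B\<close> at \<open>p\<close>.\<close>

lemma DR_fixed_point:
  fixes A B :: "'a::euclidean_space set"
  assumes A: "closed A" "convex A" and B: "closed B" "convex B"
    and p: "p \<in> A" "p \<in> B"
    and nA: "\<And>z. z \<in> A \<Longrightarrow> (u - p) \<bullet> (z - p) \<le> 0"
    and nB: "\<And>z. z \<in> B \<Longrightarrow> (p - u) \<bullet> (z - p) \<le> 0"
  shows "u \<in> Fix (DR_operator A B)"
proof -
  have proj: "closest_point C v = p"
    if C: "closed C" "convex C" "p \<in> C" and n: "\<And>z. z \<in> C \<Longrightarrow> (v - p) \<bullet> (z - p) \<le> 0"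
    for C and v :: 'a
  proof -
    \<comment> \<open>The variational inequality is that of an inexact projection with tolerance \<open>0\<close>.\<close>
    have "p \<in> inexact_proj C 0 p p v"
      using C n by (simp add: inexact_proj_def)
    from closest_point_inexact_proj[OF C(1,2) this] show ?thesis
      by simp
  qed
  have "closest_point A u = p"
    by (rule proj[OF A p(1) nA])
  moreover have "closest_point B (2 *\<^sub>R p - u) = p"
    using nB by (intro proj[OF B p(2)]) (simp add: scaleR_2)
  ultimately show ?thesis
    by (simp add: Fix_def DR_operator_def reflection_def)
qed

lemma ApDR_step_quasi_fejer:
  fixes A B :: "'a::euclidean_space set"
  assumes a: "a \<in> inexact_proj A e a' b' x"
    and b: "b \<in> inexact_proj B f b' a' (2 *\<^sub>R a - x)"
    and p: "p \<in> A" "p \<in> B"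
    and nA: "\<And>z. z \<in> A \<Longrightarrow> (u - p) \<bullet> (z - p) \<le> 0"
    and nB: "\<And>z. z \<in> B \<Longrightarrow> (p - u) \<bullet> (z - p) \<le> 0"
  shows "(norm (x + b - a - u))\<^sup>2 + (norm (a - b))\<^sup>2
           \<le> (norm (x - u))\<^sup>2 + 2 * (e + f) * (norm (a' - b'))\<^sup>2"
proof -
  have "(x - a) \<bullet> (p - a) \<le> e * (norm (a' - b'))\<^sup>2"
    using a p by (simp add: inexact_proj_def)
  moreover have "(2 *\<^sub>R a - x - b) \<bullet> (p - b) \<le> f * (norm (a' - b'))\<^sup>2"
    using b p by (simp add: inexact_proj_def norm_minus_commute)
  moreover have "(u - p) \<bullet> (a - p) \<le> 0" "(p - u) \<bullet> (b - p) \<le> 0"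
    using a b nA nB by (simp_all add: inexact_proj_def)
  \<comment> \<open>An identity: the four inner products just bounded account for the whole change.\<close>
  moreover have "(norm (x + b - a - u))\<^sup>2 + (norm (a - b))\<^sup>2 - (norm (x - u))\<^sup>2
      = 2 * ((x - a) \<bullet> (p - a) + (2 *\<^sub>R a - x - b) \<bullet> (p - b)
             + (u - p) \<bullet> (a - p) + (p - u) \<bullet> (b - p))"
    by (simp add: power2_norm_eq_inner inner_simps inner_commute algebra_simps)
  ultimately show ?thesis
    by (simp add: algebra_simps)
qed

theorem ApDR_converges:
  fixes A B :: "'a::euclidean_space set" and \<epsilon> \<delta> :: "nat \<Rightarrow> real" and c :: real
  assumes A: "closed A" "convex A" and B: "closed B" "convex B"
    and AB: "A \<inter> B \<noteq> {}"
    and nonneg: "\<And>k. 0 \<le> \<epsilon> k" "\<And>k. 0 \<le> \<delta> k"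
    and c: "\<And>k. 2 * (\<epsilon> k + \<delta> k) \<le> c" "c < 1"
    and run: "ApDR_infinite_run A B \<epsilon> \<delta> x yA yB"
  shows "\<exists>x_star \<in> Fix (DR_operator A B).
           x \<longlonglongrightarrow> x_star \<and> yA \<longlonglongrightarrow> closest_point A x_star \<and> closest_point A x_star \<in> A \<inter> B"
proof -
  \<comment> \<open>All statements on \<open>x\<close> are about \<open>x (Suc k)\<close>, because \<open>x 0\<close> is arbitrary.\<close>
  have runA: "yA (Suc k) \<in> inexact_proj A (\<epsilon> (Suc k)) (yA k) (yB k) (x (Suc k))"
    and runB: "yB (Suc k) \<in> inexact_proj B (\<delta> (Suc k)) (yB k) (yA k) (2 *\<^sub>R yA (Suc k) - x (Suc k))"
    and runx: "x (Suc (Suc k)) = x (Suc k) + yB (Suc k) - yA (Suc k)" for k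
    using run[unfolded ApDR_infinite_run_def, THEN conjunct2, THEN conjunct2,
        THEN spec, of "Suc k"] by simp_all
  define d where "d k = (norm (yA k - yB k))\<^sup>2" for k
  have eps: "\<epsilon> k \<le> 1 \<and> \<delta> k \<le> 1" for k
    using nonneg[of k] c(1)[of k] c(2) by simp
  have c0: "0 \<le> c"
    using nonneg[of 0] c(1)[of 0] by simp
  have fejer: "d \<longlonglongrightarrow> 0 \<and> convergent (\<lambda>k. (norm (x (Suc k) - u))\<^sup>2)"
    if p: "p \<in> A" "p \<in> B"
      and nA: "\<And>z. z \<in> A \<Longrightarrow> (u - p) \<bullet> (z - p) \<le> 0"
      and nB: "\<And>z. z \<in> B \<Longrightarrow> (p - u) \<bullet> (z - p) \<le> 0" for u p
  proof -
    have "(norm (x (Suc (Suc k)) - u))\<^sup>2 + d (Suc k) \<le> (norm (x (Suc k) - u))\<^sup>2 + c * d k" for k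
    proof -
      have "2 * (\<epsilon> (Suc k) + \<delta> (Suc k)) * d k \<le> c * d k"
        using c(1) by (intro mult_right_mono) (auto simp: d_def)
      then show ?thesis
        using ApDR_step_quasi_fejer[OF runA[of k] runB[of k] p nA nB]
        unfolding runx[of k] d_def by linarith
    qed
    then show ?thesis
      using perturbed_descent[of "\<lambda>k. (norm (x (Suc k) - u))\<^sup>2" d c] c0 c(2)
      by (simp add: d_def)
  qed
  obtain s where s: "s \<in> A" "s \<in> B"
    using AB by blast
  have d0: "d \<longlonglongrightarrow> 0" and conv_s: "convergent (\<lambda>k. (norm (x (Suc k) - s))\<^sup>2)"
    using fejer[of s s] s by auto
  have "bounded (range (\<lambda>k. x (Suc k)))"
  proof -
    obtain M where M: "\<And>k. (norm (x (Suc k) - s))\<^sup>2 \<le> M"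
      using convergent_imp_Bseq[OF conv_s] unfolding Bseq_def by fastforce
    have "norm (x (Suc k) - s) \<le> sqrt M" for k
      using M[of k] by (simp add: real_le_rsqrt)
    then show ?thesis
      unfolding bounded_def by (intro exI[of _ s] exI[of _ "sqrt M"])
        (auto simp: dist_norm norm_minus_commute)
  qed
  then obtain x_star r where r: "strict_mono r" and xr: "(\<lambda>k. x (Suc (r k))) \<longlonglongrightarrow> x_star"
    using bounded_imp_convergent_subsequence[of "\<lambda>k. x (Suc k)"] by (auto simp: o_def)
  define p where "p = closest_point A x_star"
  have A_ne: "A \<noteq> {}"
    using AB by blast
  have yA_close: "(\<lambda>k. dist (closest_point A (x (Suc k))) (yA (Suc k))) \<longlonglongrightarrow> 0"
  proof -
    have "(dist (closest_point A (x (Suc k))) (yA (Suc k)))\<^sup>2 \<le> d k" for k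
    proof -
      have "\<epsilon> (Suc k) * d k \<le> 1 * d k"
        using eps by (intro mult_right_mono) (auto simp: d_def)
      then show ?thesis
        using closest_point_inexact_proj[OF A runA[of k], folded d_def] by simp
    qed
    then have "(\<lambda>k. (dist (closest_point A (x (Suc k))) (yA (Suc k)))\<^sup>2) \<longlonglongrightarrow> 0"
      by (intro Lim_null_comparison[OF always_eventually d0]) simp
    then show ?thesis
      by simp
  qed
  have yA_lim: "(\<lambda>k. yA (Suc (q k))) \<longlonglongrightarrow> p"
    if q: "strict_mono q" "(\<lambda>k. x (Suc (q k))) \<longlonglongrightarrow> x_star" for q :: "nat \<Rightarrow> nat"
  proof -
    have "(\<lambda>k. closest_point A (x (Suc (q k)))) \<longlonglongrightarrow> p"
      unfolding p_def
      by (rule isCont_tendsto_compose[OF continuous_at_closest_point[OF A(2,1) A_ne] q(2)])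
    moreover have "(\<lambda>k. dist (closest_point A (x (Suc (q k)))) (yA (Suc (q k)))) \<longlonglongrightarrow> 0"
      using LIMSEQ_subseq_LIMSEQ[OF yA_close q(1)] by (simp add: o_def)
    ultimately show ?thesis
      by (auto simp: dist_norm intro: Lim_transform2 tendsto_norm_zero_cancel)
  qed
  have yAr: "(\<lambda>k. yA (Suc (r k))) \<longlonglongrightarrow> p"
    by (rule yA_lim[OF r xr])
  have dr: "(\<lambda>k. d (r k)) \<longlonglongrightarrow> 0" and dSr: "(\<lambda>k. d (Suc (r k))) \<longlonglongrightarrow> 0"
    using LIMSEQ_subseq_LIMSEQ[OF d0 r] LIMSEQ_subseq_LIMSEQ[OF LIMSEQ_Suc[OF d0] r]
    by (simp_all add: o_def)
  have "(\<lambda>k. dist (yA (Suc (r k))) (yB (Suc (r k)))) \<longlonglongrightarrow> 0"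
    using dSr by (simp add: d_def dist_norm)
  then have yBr: "(\<lambda>k. yB (Suc (r k))) \<longlonglongrightarrow> p"
    by (auto simp: dist_norm intro: Lim_transform2[OF yAr] tendsto_norm_zero_cancel)
  have pA: "p \<in> A"
    unfolding p_def by (rule closest_point_in_set[OF A(1) A_ne])
  have "yB (Suc (r k)) \<in> B" for k
    using runB by (simp add: inexact_proj_def)
  then have pB: "p \<in> B"
    by (rule closed_sequentially[OF B(1) _ yBr])
  have nA: "(x_star - p) \<bullet> (z - p) \<le> 0" if "z \<in> A" for z
    unfolding p_def by (rule closest_point_dot[OF A(2,1) that])
  have nB: "(p - x_star) \<bullet> (z - p) \<le> 0" if "z \<in> B" for z
  proof -
    have "(2 *\<^sub>R yA (Suc (r k)) - x (Suc (r k)) - yB (Suc (r k))) \<bullet> (z - yB (Suc (r k)))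
        \<le> d (r k)" for k
    proof -
      have "\<delta> (Suc (r k)) * d (r k) \<le> 1 * d (r k)"
        using eps by (intro mult_right_mono) (auto simp: d_def)
      moreover have "(2 *\<^sub>R yA (Suc (r k)) - x (Suc (r k)) - yB (Suc (r k))) \<bullet> (z - yB (Suc (r k)))
          \<le> \<delta> (Suc (r k)) * d (r k)"
        using runB[of "r k"] that by (simp add: inexact_proj_def d_def norm_minus_commute)
      ultimately show ?thesis
        by simp
    qed
    moreover have "(\<lambda>k. (2 *\<^sub>R yA (Suc (r k)) - x (Suc (r k)) - yB (Suc (r k))) \<bullet> (z - yB (Suc (r k))))
        \<longlonglongrightarrow> (2 *\<^sub>R p - x_star - p) \<bullet> (z - p)"
      by (intro tendsto_intros yAr xr yBr)
    ultimately have "(2 *\<^sub>R p - x_star - p) \<bullet> (z - p) \<le> 0"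
      using LIMSEQ_le[OF _ dr] by blast
    then show ?thesis
      by (simp add: scaleR_2)
  qed
  obtain l where l: "(\<lambda>k. (norm (x (Suc k) - x_star))\<^sup>2) \<longlonglongrightarrow> l"
    using fejer[OF pA pB nA nB] by (auto simp: convergent_def)
  have "(\<lambda>k. (norm (x (Suc (r k)) - x_star))\<^sup>2) \<longlonglongrightarrow> (norm (x_star - x_star))\<^sup>2"
    by (intro tendsto_intros xr)
  moreover have "(\<lambda>k. (norm (x (Suc (r k)) - x_star))\<^sup>2) \<longlonglongrightarrow> l"
    using LIMSEQ_subseq_LIMSEQ[OF l r] by (simp add: o_def)
  ultimately have "(norm (x_star - x_star))\<^sup>2 = l"
    by (rule LIMSEQ_unique)
  then have "(\<lambda>k. norm (x (Suc k) - x_star)) \<longlonglongrightarrow> 0"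
    using l by simp
  then have xS: "(\<lambda>k. x (Suc k)) \<longlonglongrightarrow> x_star"
    by (rule LIM_zero_cancel[OF tendsto_norm_zero_cancel])
  then have "(\<lambda>k. yA (Suc k)) \<longlonglongrightarrow> p"
    using yA_lim[of "\<lambda>k. k"] by (simp add: strict_mono_def)
  then have "yA \<longlonglongrightarrow> p"
    by (rule LIMSEQ_imp_Suc)
  moreover have "x \<longlonglongrightarrow> x_star"
    using xS by (rule LIMSEQ_imp_Suc)
  moreover have "x_star \<in> Fix (DR_operator A B)"
    by (rule DR_fixed_point[OF A B pA pB nA nB])
  ultimately show ?thesis
    using pA pB unfolding p_def by (intro bexI[of _ x_star]) simp_all
qed

theorem theorem7:
  fixes A B :: "(real ^ 'n) set"
    and \<epsilon> \<delta> :: "nat \<Rightarrow> real" and \<epsilon>_bar :: real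
    and x yA yB :: "nat \<Rightarrow> real ^ 'n"
  assumes "A \<noteq> {}" "closed A" "convex A"
    and "B \<noteq> {}" "closed B" "convex B"
    and "A \<inter> B \<noteq> {}"
    and "compact A"
    and "\<And>k. 0 \<le> \<epsilon> k" "\<And>k. 0 \<le> \<delta> k"
    and "\<epsilon>_bar \<noteq> 0"
    and "\<And>k. 0 \<le> 2 * (\<epsilon> k + \<delta> k)" "\<And>k. 2 * (\<epsilon> k + \<delta> k) \<le> \<epsilon>_bar" "\<epsilon>_bar < 1"
    and "ApDR_infinite_run A B \<epsilon> \<delta> x yA yB"
  shows "\<exists>x_star \<in> Fix (DR_operator A B).
           x \<longlonglongrightarrow> x_star \<and>
           yA \<longlonglongrightarrow> closest_point A x_star \<and>
           closest_point A x_star \<in> A \<inter> B"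
  by (rule ApDR_converges[OF assms(2,3,5,6,7,9,10,13,14,15)])

end
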